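(* Let $\mathbf c\in\mathbb Z_{\ge 0}^n$ and let $M$ be a proper $\mathbf c$-multicomplex. Then the Bier sphere $\mathrm{Bier}_{\mathbf c}(M)$ is shellable.
   Context: Fix $n\ge 1$ and $\mathbf c=(c_1,\dots,c_n)\in\mathbb Z_{\ge0}^n$; put $|\mathbf c|=c_1+\cdots+c_n$. For $\mathbf a\in\mathbb Z_{\ge0}^n$ write $x^{\mathbf a}=x_1^{a_1}\cdots x_n^{a_n}$. A $\mathbf c$-monomial is a monomial $x^{\mathbf a}$ with $a_i\le c_i$ for all $i$. A $\mathbf c$-multicomplex is a nonempty set $M$ of $\mathbf c$-monomials such that $u\in M$ and $v\mid u$ imply $v\in M$; it is called $\mathbf c$-full if it is the set of all $\mathbf c$-monomials and proper otherwise. Let $\widetilde X_i=\{x_i^{(0)},x_i^{(1)},\dots,x_i^{(c_i)}\}$ ($i=1,\dots,n$) be pairwise disjoint sets of new symbols and $\widetilde X=\bigcup_i\widetilde X_i$. For a $\mathbf c$-monomial $x^{\mathbf a}$ let $F_{\mathbf c}(x^{\mathbf a})=\widetilde X\setminus\{x_1^{(a_1)},\dots,x_n^{(a_n)}\}$, and for a $\mathbf c$-multicomplex $M$ let $\mathcal B_{\mathbf c}(M)$ be the simplicial complex on $\widetilde X$ whose faces are all subsets of the sets $F_{\mathbf c}(x^{\mathbf a})$, $x^{\mathbf a}\in M$. For a pure $(d-1)$-dimensional simplicial complex $B$, its boundary $\partial B$ is the simplicial complex generated by the $(d-1)$-element faces of $B$ contained in exactly one facet of $B$. For a proper $\mathbf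 c$-multicomplex $M$, the Bier sphere of $M$ is $\mathrm{Bier}_{\mathbf c}(M)=\partial\mathcal B_{\mathbf c}(M)$. A pure $(d-1)$-dimensional simplicial complex $\Delta$ is shellable if its facets admit an order $F_1,\dots,F_s$ such that for each $i\ge2$ the complex $\langle F_1,\dots,F_{i-1}\rangle\cap\langle F_i\rangle$ is generated by subsets of $F_i$ of cardinality $d-1$, where $\langle G_1,\dots,G_k\rangle$ denotes the set of all subsets of some $G_j$. *)

theory Defs
  imports Main
begin

text \<open>
  The monomial \<open>x\<^sub>1^a\<^sub>1 \<cdots> x\<^sub>n^a\<^sub>n\<close> is represented by its exponent vector \<open>a :: nat \<Rightarrow> nat\<close>,
  normalised to vanish outside \<open>{1..n}\<close>; multiplication of monomials is addition of exponent
  vectors.  Of the bound \<open>c :: nat \<Rightarrow> nat\<close> only the values on \<open>{1..n}\<close> matter.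
\<close>

definition cmonomials :: "nat \<Rightarrow> (nat \<Rightarrow> nat) \<Rightarrow> (nat \<Rightarrow> nat) set" where
  "cmonomials n c = {a. (\<forall>i\<in>{1..n}. a i \<le> c i) \<and> (\<forall>i. i \<notin> {1..n} \<longrightarrow> a i = 0)}"

definition monom_dvd :: "(nat \<Rightarrow> nat) \<Rightarrow> (nat \<Rightarrow> nat) \<Rightarrow> bool" where
  "monom_dvd v u \<longleftrightarrow> (\<exists>w. u = (\<lambda>i. v i + w i))"

definition multicomplex :: "nat \<Rightarrow> (nat \<Rightarrow> nat) \<Rightarrow> (nat \<Rightarrow> nat) set \<Rightarrow> bool" where
  "multicomplex n c M \<longleftrightarrow>
     M \<noteq> {} \<and> M \<subseteq> cmonomials n c \<and> (\<forall>u v. u \<in> M \<longrightarrow> monom_dvd v u \<longrightarrow> v \<in> M)"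

definition full_multicomplex :: "nat \<Rightarrow> (nat \<Rightarrow> nat) \<Rightarrow> (nat \<Rightarrow> nat) set \<Rightarrow> bool" where
  "full_multicomplex n c M \<longleftrightarrow> multicomplex n c M \<and> M = cmonomials n c"

definition proper_multicomplex :: "nat \<Rightarrow> (nat \<Rightarrow> nat) \<Rightarrow> (nat \<Rightarrow> nat) set \<Rightarrow> bool" where
  "proper_multicomplex n c M \<longleftrightarrow> multicomplex n c M \<and> \<not> full_multicomplex n c M"

text \<open>
  Simplicial complexes are finite and contain the empty face; the void complex \<open>{}\<close> is excluded,
  while \<open>{{}}\<close> is the complex of dimension \<open>-1\<close>.
\<close>

definition simplicial_complex :: "'v set set \<Rightarrow> bool" where
  "simplicial_complex \<Delta> \<longleftrightarrow>
     \<Delta> \<noteq> {} \<and> finite \<Delta> \<and> (\<forall>F\<in>\<Delta>. finite F) \<and> (\<forall>F\<in>\<Delta>. \<forall>G. G \<subseteq> F \<longrightarrow> G \<in> \<Delta>)"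

definition generated :: "'v set set \<Rightarrow> 'v set set" where
  "generated S = {G. \<exists>F\<in>S. G \<subseteq> F}"

definition facets :: "'v set set \<Rightarrow> 'v set set" where
  "facets \<Delta> = {F\<in>\<Delta>. \<forall>G\<in>\<Delta>. F \<subseteq> G \<longrightarrow> G = F}"

text \<open>\<open>sc_rank \<Delta> = d\<close> means that \<open>\<Delta>\<close> has dimension \<open>d - 1\<close>.\<close>

definition sc_rank :: "'v set set \<Rightarrow> nat" where
  "sc_rank \<Delta> = Max (card ` \<Delta>)"

definition pure_complex :: "'v set set \<Rightarrow> bool" where
  "pure_complex \<Delta> \<longleftrightarrow> (\<forall>F\<in>facets \<Delta>. card F = sc_rank \<Delta>)"

text \<open>Cardinality \<open>d - 1\<close> is written additively, avoiding truncated subtraction when \<open>d = 0\<close>.\<close>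

definition boundary :: "'v set set \<Rightarrow> 'v set set" where
  "boundary B = generated {G\<in>B. card G + 1 = sc_rank B \<and> (\<exists>!F. F \<in> facets B \<and> G \<subseteq> F)}"

definition shellable :: "'v set set \<Rightarrow> bool" where
  "shellable \<Delta> \<longleftrightarrow> simplicial_complex \<Delta> \<and> pure_complex \<Delta> \<and>
     (\<exists>Fs. distinct Fs \<and> set Fs = facets \<Delta> \<and>
        (\<forall>i. 1 \<le> i \<and> i < length Fs \<longrightarrow>
           (\<exists>S \<subseteq> {G. G \<subseteq> Fs ! i \<and> card G + 1 = sc_rank \<Delta>}.
              generated (set (take i Fs)) \<inter> generated {Fs ! i} = generated S)))"

text \<open>The symbol \<open>x\<^sub>i^(j)\<close> is the pair \<open>(i, j)\<close>.\<close>

definition vertices :: "nat \<Rightarrow> (nat \<Rightarrow> nat) \<Rightarrow> (nat \<times> nat) set" where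
  "vertices n c = (SIGMA i:{1..n}. {0..c i})"

definition bier_facet :: "nat \<Rightarrow> (nat \<Rightarrow> nat) \<Rightarrow> (nat \<Rightarrow> nat) \<Rightarrow> (nat \<times> nat) set" where
  "bier_facet n c a = vertices n c - (\<lambda>i. (i, a i)) ` {1..n}"

definition bier_ball :: "nat \<Rightarrow> (nat \<Rightarrow> nat) \<Rightarrow> (nat \<Rightarrow> nat) set \<Rightarrow> (nat \<times> nat) set set" where
  "bier_ball n c M = generated (bier_facet n c ` M)"

definition bier_sphere :: "nat \<Rightarrow> (nat \<Rightarrow> nat) \<Rightarrow> (nat \<Rightarrow> nat) set \<Rightarrow> (nat \<times> nat) set set" where
  "bier_sphere n c M = boundary (bier_ball n c M)"

lemma monom_dvd_iff: "monom_dvd v u \<longleftrightarrow> (\<forall>i. v i \<le> u i)"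
proof
  assume "\<forall>i. v i \<le> u i"
  then have "u = (\<lambda>i. v i + (u i - v i))" by auto
  then show "monom_dvd v u" unfolding monom_dvd_def by (rule exI[where x = "\<lambda>i. u i - v i"])
qed (auto simp: monom_dvd_def)

lemma finite_vertices: "finite (vertices n c)"
  by (simp add: vertices_def)

lemma card_bier_facet:
  assumes "a \<in> cmonomials n c"
  shows "card (bier_facet n c a) = (\<Sum>i=1..n. c i)"
proof -
  have sub: "(\<lambda>i. (i, a i)) ` {1..n} \<subseteq> vertices n c"
    using assms by (auto simp: vertices_def cmonomials_def)
  have "card ((\<lambda>i. (i, a i)) ` {1..n}) = n"
    by (subst card_image) (auto simp: inj_on_def)
  moreover have "card (vertices n c) = (\<Sum>i=1..n. c i) + n"
    by (simp add: vertices_def sum_Suc)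
  ultimately show ?thesis
    using card_Diff_subset[OF finite_subset[OF sub finite_vertices] sub]
    by (simp add: bier_facet_def)
qed

text \<open>The complex whose boundary is taken is pure of dimension \<open>|c| - 1\<close>.\<close>

lemma bier_ball_pure:
  assumes "multicomplex n c M"
  shows "simplicial_complex (bier_ball n c M)" "facets (bier_ball n c M) = bier_facet n c ` M"
    "sc_rank (bier_ball n c M) = (\<Sum>i=1..n. c i)" "pure_complex (bier_ball n c M)"
proof -
  let ?B = "bier_ball n c M"
  have card: "card (bier_facet n c a) = (\<Sum>i=1..n. c i)" if "a \<in> M" for a
    using that assms card_bier_facet by (auto simp: multicomplex_def)
  have fin: "finite (bier_facet n c a)" for a
    by (simp add: bier_facet_def finite_vertices)
  have "?B \<subseteq> Pow (vertices n c)"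
    by (auto simp: bier_ball_def generated_def bier_facet_def)
  then have finB: "finite ?B" by (rule finite_subset) (simp add: finite_vertices)
  have ne: "M \<noteq> {}" using assms by (simp add: multicomplex_def)
  have "?B \<noteq> {}" using ne by (auto simp: bier_ball_def generated_def)
  moreover have "finite F" if "F \<in> ?B" for F
    using that fin by (auto simp: bier_ball_def generated_def intro: finite_subset)
  ultimately show "simplicial_complex ?B"
    using finB unfolding simplicial_complex_def
    by (simp add: bier_ball_def generated_def) (meson subset_trans)
  show fac: "facets ?B = bier_facet n c ` M"
  proof
    show "facets ?B \<subseteq> bier_facet n c ` M"
      by (fastforce simp: facets_def bier_ball_def generated_def)
    show "bier_facet n c ` M \<subseteq> facets ?B"
    proof
      fix F assume "F \<in> bier_facet n c ` M"
      then obtain a where a: "a \<in> M" "F = bier_facet n c a" by auto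
      have "G = F" if G: "G \<in> ?B" "F \<subseteq> G" for G
      proof -
        obtain b where b: "b \<in> M" "G \<subseteq> bier_facet n c b"
          using G(1) by (auto simp: bier_ball_def generated_def)
        then have "F = bier_facet n c b"
          using G(2) a card fin by (metis card_subset_eq subset_trans)
        then show ?thesis using b G by auto
      qed
      then show "F \<in> facets ?B"
        using a by (auto simp: facets_def bier_ball_def generated_def)
    qed
  qed
  show rk: "sc_rank ?B = (\<Sum>i=1..n. c i)"
    unfolding sc_rank_def
  proof (rule Max_eqI)
    show "finite (card ` ?B)" using finB by simp
    show "y \<le> (\<Sum>i=1..n. c i)" if "y \<in> card ` ?B" for y
      using that card fin by (auto simp: bier_ball_def generated_def) (metis card_mono)
    show "(\<Sum>i=1..n. c i) \<in> card ` ?B"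
      using ne card by (force simp: bier_ball_def generated_def image_iff)
  qed
  show "pure_complex ?B" using fac rk card by (auto simp: pure_complex_def)
qed

end

theory Submission
  imports Defs "HOL-Library.List_Lexorder" "HOL-Library.Product_Lexorder"
begin

text \<open>
  A facet of the Bier sphere is the complement of a set containing two symbols \<open>x\<^sub>i^(p)\<close>, \<open>x\<^sub>i^(q)\<close> with
  \<open>p < q\<close> for one \<open>i\<close> and a single symbol \<open>x\<^sub>j^(u\<^sub>j)\<close> for every other \<open>j\<close>: an edge in direction \<open>i\<close> leading
  from \<open>M\<close> to its complement.  Such edges are ordered lexicographically from position \<open>1\<close> on.
  Left of \<open>i\<close> large entries come first, right of \<open>i\<close> small entries come first; at \<open>i\<close>
  itself large \<open>q\<close> come first, then small \<open>p\<close>, and \<open>{p, q}\<close> comes directly after the singleton \<open>{q}\<close>.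
  If \<open>y\<close> precedes \<open>x\<close>, some symbol of \<open>y\<close> raises an entry of \<open>x\<close> left of \<open>i\<close>, lowers one right of \<open>i\<close>, or
  widens \<open>{p, q}\<close>; exchanging it into \<open>x\<close> gives an adjacent facet that precedes \<open>x\<close>.
\<close>

section \<open>Shellings obtained from a linear order\<close>

lemma facets_generated_equicard:
  assumes fin: "\<And>F. F \<in> A \<Longrightarrow> finite F" and card: "\<And>F. F \<in> A \<Longrightarrow> card F = d"
  shows "facets (generated A) = A"
proof
  show "facets (generated A) \<subseteq> A"
    by (fastforce simp: facets_def generated_def)
  show "A \<subseteq> facets (generated A)"
  proof
    fix F assume F: "F \<in> A"
    have "G = F" if G: "G \<in> generated A" "F \<subseteq> G" for G
    proof -
      obtain H where H: "H \<in> A" "G \<subseteq> H" using G(1) by (auto simp: generated_def)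
      then have "F = H" using F G(2) fin card by (metis card_subset_eq subset_trans)
      then show ?thesis using G(2) H(2) by auto
    qed
    then show "F \<in> facets (generated A)" using F by (auto simp: facets_def generated_def)
  qed
qed

lemma sc_rank_generated_equicard:
  assumes "finite A" "A \<noteq> {}" and fin: "\<And>F. F \<in> A \<Longrightarrow> finite F" and card: "\<And>F. F \<in> A \<Longrightarrow> card F = d"
  shows "sc_rank (generated A) = d"
  unfolding sc_rank_def
proof (rule Max_eqI)
  have "generated A = (\<Union>F\<in>A. Pow F)" by (auto simp: generated_def)
  then show "finite (card ` generated A)" using assms(1) fin by simp
  show "y \<le> d" if "y \<in> card ` generated A" for y
    using that card fin by (auto simp: generated_def) (metis card_mono)
  show "d \<in> card ` generated A"
    using assms(2) card by (force simp: generated_def image_iff)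
qed

text \<open>Listing the facets by increasing key is a shelling: \<open>step\<close> puts every
  intersection of \<open>F x\<close> with an earlier facet inside a ridge \<open>F x - {v}\<close>
  that itself lies in an earlier facet, so such ridges generate the whole intersection.\<close>

lemma shellable_generated_by_key:
  fixes F :: "'i \<Rightarrow> 'v set" and key :: "'i \<Rightarrow> 'k::linorder"
  assumes "finite I" "I \<noteq> {}" and inj: "inj_on key I"
    and fin: "\<And>x. x \<in> I \<Longrightarrow> finite (F x)" and card: "\<And>x. x \<in> I \<Longrightarrow> card (F x) = d"
    and step: "\<And>x y. \<lbrakk>x \<in> I; y \<in> I; key y < key x\<rbrakk> \<Longrightarrow>
      \<exists>z\<in>I. \<exists>v\<in>F x - F y. key z < key x \<and> F x - {v} \<subseteq> F z"
  shows "shellable (generated (F ` I))"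
proof -
  let ?A = "F ` I"
  have fac: "facets (generated ?A) = ?A"
    by (rule facets_generated_equicard[where d = d]) (use assms in auto)
  have rank: "sc_rank (generated ?A) = d"
    by (rule sc_rank_generated_equicard) (use assms in auto)
  have "generated ?A = (\<Union>G\<in>?A. Pow G)" by (auto simp: generated_def)
  then have sc: "simplicial_complex (generated ?A)"
    using assms(1,2) fin unfolding simplicial_complex_def
    by (auto intro: finite_subset) blast
  have injF: "inj_on F I"
  proof (rule inj_onI, rule ccontr)
    fix x y assume xy: "x \<in> I" "y \<in> I" "F x = F y" "x \<noteq> y"
    then have "key x < key y \<or> key y < key x" using inj by (meson inj_onD linorder_neqE)
    \<comment> \<open>For equal sets \<open>F x - F y\<close> is empty, so \<open>step\<close>
      cannot supply its \<open>v\<close>.\<close>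
    then show False using xy step[of x y] step[of y x] by auto
  qed
  obtain xs0 where xs0: "set xs0 = I" "distinct xs0" using finite_distinct_list[OF assms(1)] by auto
  define xs where "xs = sort_key key xs0"
  have xs: "set xs = I" "distinct xs" "sorted (map key xs)" using xs0 by (auto simp: xs_def)
  have less: "key (xs ! j) < key (xs ! i)" if "j < i" "i < length xs" for i j
  proof -
    have "key (xs ! j) \<le> key (xs ! i)" using xs(3) that sorted_nth_mono[of "map key xs" j i] by simp
    moreover have "xs ! j \<noteq> xs ! i" using xs(2) that by (simp add: nth_eq_iff_index_eq)
    then have "key (xs ! j) \<noteq> key (xs ! i)"
      using inj xs(1) that by (meson inj_onD less_trans nth_mem)
    ultimately show ?thesis by simp
  qed
  have earlier: "set (take i xs) = {z \<in> I. key z < key (xs ! i)}" if i: "i < length xs" for i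
  proof (intro equalityI subsetI)
    fix z assume "z \<in> set (take i xs)"
    then obtain j where "j < i" "z = xs ! j" using i by (auto simp: in_set_conv_nth)
    then show "z \<in> {z \<in> I. key z < key (xs ! i)}" using less i xs(1) by auto
  next
    fix z assume z: "z \<in> {z \<in> I. key z < key (xs ! i)}"
    then obtain j where j: "j < length xs" "z = xs ! j" using xs(1) by (auto simp: in_set_conv_nth)
    have "j < i" using less[of i j] z j
      by (metis (no_types, lifting) linorder_neqE_nat mem_Collect_eq order_less_asym order_less_irrefl)
    then show "z \<in> set (take i xs)" using j i by (auto simp: in_set_conv_nth)
  qed
  have "\<exists>S \<subseteq> {G. G \<subseteq> map F xs ! i \<and> card G + 1 = d}.
      generated (set (take i (map F xs))) \<inter> generated {map F xs ! i} = generated S"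
    if i: "i < length xs" for i
  proof -
    define x where "x = xs ! i"
    have x: "x \<in> I" using i xs(1) by (auto simp: x_def)
    define E where "E = {z \<in> I. key z < key x}"
    have E: "set (take i (map F xs)) = F ` E" using earlier[OF i] by (simp add: take_map E_def x_def)
    define S where "S = {F x - {v} | v. v \<in> F x \<and> (\<exists>z\<in>E. F x - {v} \<subseteq> F z)}"
    have "S \<subseteq> {G. G \<subseteq> F x \<and> card G + 1 = d}"
      using card[OF x] card.remove[OF fin[OF x]] by (auto simp: S_def)
    moreover have "generated (F ` E) \<inter> generated {F x} = generated S"
    proof (intro equalityI subsetI)
      fix G assume "G \<in> generated (F ` E) \<inter> generated {F x}"
      then obtain y where y: "y \<in> E" "G \<subseteq> F y" "G \<subseteq> F x" by (auto simp: generated_def)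
      then obtain z v where "z \<in> I" "v \<in> F x - F y" "key z < key x" "F x - {v} \<subseteq> F z"
        using step[OF x, of y] unfolding E_def by blast
      then have "F x - {v} \<in> S" "G \<subseteq> F x - {v}" using y by (auto simp: S_def E_def)
      then show "G \<in> generated S" by (auto simp: generated_def)
    next
      fix G assume "G \<in> generated S"
      then show "G \<in> generated (F ` E) \<inter> generated {F x}"
        unfolding generated_def S_def by blast
    qed
    ultimately show ?thesis using i E by (auto simp: x_def)
  qed
  moreover have "distinct (map F xs)" "set (map F xs) = ?A"
    using xs injF by (auto simp: distinct_map)
  ultimately show ?thesis
    unfolding shellable_def pure_complex_def fac rank
    using sc card by (intro conjI exI[of _ "map F xs"]) auto
qed

section \<open>Edges leaving the multicomplex and their lexicographic keys\<close>

lemma map_upt_less_iff: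
  fixes f g :: "nat \<Rightarrow> 'a::linorder"
  shows "map f [1..<Suc n] < map g [1..<Suc n] \<longleftrightarrow>
    (\<exists>k\<in>{1..n}. (\<forall>j\<in>{1..<k}. f j = g j) \<and> f k < g k)"
proof -
  \<comment> \<open>Both lists have length \<open>n\<close>, so neither is a proper prefix of the
    other and only the first difference decides.\<close>
  have "map f [1..<Suc n] < map g [1..<Suc n] \<longleftrightarrow>
      (\<exists>i<n. (\<forall>j<i. f (Suc j) = g (Suc j)) \<and> f (Suc i) < g (Suc i))"
    by (auto simp: list_less_def lexord_take_index_conv list_eq_iff_nth_eq simp del: upt_Suc)
  also have "\<dots> \<longleftrightarrow> (\<exists>k\<in>{1..n}. (\<forall>j\<in>{1..<k}. f j = g j) \<and> f k < g k)"
  proof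
    assume "\<exists>i<n. (\<forall>j<i. f (Suc j) = g (Suc j)) \<and> f (Suc i) < g (Suc i)"
    then obtain i where i: "i < n" "\<forall>j<i. f (Suc j) = g (Suc j)" "f (Suc i) < g (Suc i)" by blast
    have "f j = g j" if "j \<in> {1..<Suc i}" for j using i(2) that by (cases j) auto
    then show "\<exists>k\<in>{1..n}. (\<forall>j\<in>{1..<k}. f j = g j) \<and> f k < g k"
      using i by (intro bexI[of _ "Suc i"]) auto
  next
    assume "\<exists>k\<in>{1..n}. (\<forall>j\<in>{1..<k}. f j = g j) \<and> f k < g k"
    then obtain k where k: "k \<in> {1..n}" "\<forall>j\<in>{1..<k}. f j = g j" "f k < g k" by blast
    then show "\<exists>i<n. (\<forall>j<i. f (Suc j) = g (Suc j)) \<and> f (Suc i) < g (Suc i)"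
      by (intro exI[of _ "k - 1"]) auto
  qed
  finally show ?thesis .
qed

text \<open>The triple \<open>(u, i, q)\<close> stands for the edge from \<open>u \<in> M\<close> to \<open>u(i := q) \<notin> M\<close>, so \<open>p = u i\<close>.\<close>

definition bier_index :: "nat \<Rightarrow> (nat \<Rightarrow> nat) \<Rightarrow> (nat \<Rightarrow> nat) set \<Rightarrow> ((nat \<Rightarrow> nat) \<times> nat \<times> nat) set" where
  "bier_index n c M = {(u, i, q). u \<in> M \<and> i \<in> {1..n} \<and> u i < q \<and> q \<le> c i \<and> u(i := q) \<notin> M}"

fun sphere_facet :: "nat \<Rightarrow> (nat \<Rightarrow> nat) \<Rightarrow> (nat \<Rightarrow> nat) \<times> nat \<times> nat \<Rightarrow> (nat \<times> nat) set" where
  "sphere_facet n c (u, i, q) = bier_facet n c u - {(i, q)}"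

lemma mem_bier_facet_iff: "(j, r) \<in> bier_facet n c u \<longleftrightarrow> (j, r) \<in> vertices n c \<and> r \<noteq> u j"
  by (auto simp: bier_facet_def vertices_def)

text \<open>Negation makes large entries sort first, hence the integers. The second component is
  positive exactly at \<open>i\<close>: it marks the direction and places the pair behind the single
  entry \<open>q\<close>, whose code is \<open>(- int q, 0)\<close> when it stands left of the
  direction.\<close>

fun position_key :: "(nat \<Rightarrow> nat) \<times> nat \<times> nat \<Rightarrow> nat \<Rightarrow> int \<times> int" where
  "position_key (u, i, q) j =
    (if j < i then (- int (u j), 0) else if j = i then (- int q, 1 + int (u i)) else (int (u j), 0))"

definition shelling_key :: "nat \<Rightarrow> (nat \<Rightarrow> nat) \<times> nat \<times> nat \<Rightarrow> (int \<times> int) list" where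
  "shelling_key n x = map (position_key x) [1..<Suc n]"

lemma shelling_key_less_iff:
  "shelling_key n x < shelling_key n y \<longleftrightarrow>
    (\<exists>k\<in>{1..n}. (\<forall>j\<in>{1..<k}. position_key x j = position_key y j) \<and> position_key x k < position_key y k)"
  unfolding shelling_key_def by (rule map_upt_less_iff)

lemma shelling_key_lessI:
  assumes "k \<in> {1..n}" "\<And>j. j < k \<Longrightarrow> position_key x j = position_key y j" "position_key x k < position_key y k"
  shows "shelling_key n x < shelling_key n y"
  unfolding shelling_key_less_iff using assms by (intro bexI[of _ k]) simp_all

lemma multicomplex_downward:
  assumes "multicomplex n c M" "u \<in> M" "\<And>i. v i \<le> u i"
  shows "v \<in> M"
  using assms by (auto simp: multicomplex_def monom_dvd_iff)

lemma cmonomial_upd: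
  assumes "u \<in> cmonomials n c" "i \<in> {1..n}" "q \<le> c i"
  shows "u(i := q) \<in> cmonomials n c"
  using assms by (auto simp: cmonomials_def)

text \<open>The only nonzero second component reveals \<open>i\<close>; the entries of the key then
  give \<open>q\<close> and \<open>u\<close> on \<open>{1..n}\<close>, and \<open>u\<close> vanishes
  elsewhere.\<close>

lemma inj_on_shelling_key:
  assumes "multicomplex n c M"
  shows "inj_on (shelling_key n) (bier_index n c M)"
proof (rule inj_onI)
  fix x y assume x: "x \<in> bier_index n c M" and y: "y \<in> bier_index n c M"
    and eq: "shelling_key n x = shelling_key n y"
  obtain u i q u' i' q' where xy: "x = (u, i, q)" "y = (u', i', q')" by (metis prod_cases3)
  have i: "i \<in> {1..n}" "i' \<in> {1..n}" and u: "u \<in> cmonomials n c" "u' \<in> cmonomials n c"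
    using x y assms by (auto simp: xy bier_index_def multicomplex_def)
  have pos: "position_key x j = position_key y j" if "j \<in> {1..n}" for j
    using eq that by (auto simp: shelling_key_def simp del: upt_Suc)
  have "i = i'" using pos[OF i(1)] pos[OF i(2)] by (auto simp: xy split: if_splits)
  moreover have "q = q'" using pos[OF i(1)] \<open>i = i'\<close> by (auto simp: xy)
  moreover have "u j = u' j" for j
    using pos[of j] u \<open>i = i'\<close> by (cases "j \<in> {1..n}") (auto simp: xy cmonomials_def split: if_splits)
  ultimately show "x = y" by (auto simp: xy)
qed

section \<open>Exchanging one symbol to reach an earlier facet\<close>

text \<open>
  Changing entry \<open>j \<noteq> i\<close> to \<open>r\<close> spans a square with the edge \<open>(u, i, q)\<close>.  Exactly two edges of this
  square lead from \<open>M\<close> to its complement; \<open>z\<close> is the other one, and may have direction \<open>j\<close>.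
\<close>

lemma exchange_to_smaller_key:
  assumes M: "multicomplex n c M" and x: "(u, i, q) \<in> bier_index n c M"
    and j: "j \<in> {1..n}" and r: "r \<le> c j"
    and dir: "j < i \<and> u j < r \<or> i < j \<and> r < u j \<or> j = i \<and> (r < u i \<or> q < r)"
  shows "\<exists>z\<in>bier_index n c M. shelling_key n z < shelling_key n (u, i, q) \<and>
    sphere_facet n c (u, i, q) - {(j, r)} \<subseteq> sphere_facet n c z"
proof -
  have u: "u \<in> M" "i \<in> {1..n}" "u i < q" "q \<le> c i" "u(i := q) \<notin> M"
    using x by (auto simp: bier_index_def)
  have uc: "\<And>k. k \<in> {1..n} \<Longrightarrow> u k \<le> c k"
    using u(1) M by (auto simp: multicomplex_def cmonomials_def)
  note down = multicomplex_downward[OF M]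
  consider (raise) "j < i" "u j < r" | (lower) "i < j" "r < u j" | (min) "j = i" "r < u i" | (max) "j = i" "q < r"
    using dir by blast
  then show ?thesis
  proof cases
    case raise
    show ?thesis
    proof (cases "u(j := r) \<in> M")
      case True
      have "u(j := r, i := q) \<notin> M"
        using down[of "u(j := r, i := q)" "u(i := q)"] u(5) raise by force
      then show ?thesis using True raise u j
        by (intro bexI[of _ "(u(j := r), i, q)"] conjI subrelI shelling_key_lessI[where k = j])
          (auto simp: bier_index_def mem_bier_facet_iff split: if_splits)
    next
      case False
      \<comment> \<open>The direction moves left to \<open>j\<close>, where the key becomes
        \<open>(-r, 1 + u j)\<close>. This is still below \<open>(-u j, 0)\<close> because
        \<open>r\<close> exceeds \<open>u j\<close>.\<close>
      then show ?thesis using raise u j r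
        by (intro bexI[of _ "(u, j, r)"] conjI subrelI shelling_key_lessI[where k = j])
          (auto simp: bier_index_def mem_bier_facet_iff split: if_splits)
    qed
  next
    case lower
    show ?thesis
    proof (cases "u(i := q, j := r) \<in> M")
      case True
      \<comment> \<open>The new edge ends at \<open>u(i := q)\<close> and has direction
        \<open>j\<close>, right of \<open>i\<close>. At \<open>i\<close> its key is
        \<open>(-q, 0)\<close>, which beats \<open>(-q, 1 + u i)\<close> only through the second
        component.\<close>
      have "u(i := q, j := u j) = u(i := q)" using lower by auto
      then show ?thesis using True lower u j uc[OF j]
        by (intro bexI[of _ "(u(i := q, j := r), j, u j)"] conjI subrelI shelling_key_lessI[where k = i])
          (auto simp: bier_index_def mem_bier_facet_iff split: if_splits)
    next
      case False
      have "u(j := r) \<in> M" using down[of u "u(j := r)"] u(1) lower by auto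
      then show ?thesis using False lower u j
        by (intro bexI[of _ "(u(j := r), i, q)"] conjI subrelI shelling_key_lessI[where k = j])
          (auto simp: bier_index_def mem_bier_facet_iff fun_upd_twist split: if_splits)
    qed
  next
    case min
    have "u(i := r) \<in> M" using down[of u "u(i := r)"] u(1) min by auto
    then show ?thesis using min u
      by (intro bexI[of _ "(u(i := r), i, q)"] conjI subrelI shelling_key_lessI[where k = i])
        (auto simp: bier_index_def mem_bier_facet_iff split: if_splits)
  next
    case max
    have "u(i := r) \<notin> M" using down[of "u(i := r)" "u(i := q)"] u(5) max by force
    then show ?thesis using max u r
      by (intro bexI[of _ "(u, i, r)"] conjI subrelI shelling_key_lessI[where k = i])
        (auto simp: bier_index_def mem_bier_facet_iff split: if_splits)
  qed
qed

text \<open>The condition on \<open>r\<close> keeps \<open>(j, r)\<close> out of the facet of the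
  earlier edge; the other disjunction is the hypothesis \<open>dir\<close> of
  \<open>exchange_to_smaller_key\<close>. The first position \<open>k\<close> where the keys differ
  supplies the symbol, unless \<open>k = i < i'\<close> and \<open>u' i = q\<close>; then it is
  found right of \<open>i\<close>.\<close>

lemma exchange_direction_exists:
  assumes M: "multicomplex n c M"
    and x: "(u, i, q) \<in> bier_index n c M" and y: "(u', i', q') \<in> bier_index n c M"
    and less: "shelling_key n (u', i', q') < shelling_key n (u, i, q)"
  shows "\<exists>j\<in>{1..n}. \<exists>r. (r = u' j \<or> j = i' \<and> r = q') \<and>
    (j < i \<and> u j < r \<or> i < j \<and> r < u j \<or> j = i \<and> (r < u i \<or> q < r))"
proof -
  have u: "u \<in> M" "i \<in> {1..n}" "u i < q" "u(i := q) \<notin> M"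
    and u': "u' \<in> M" "i' \<in> {1..n}" "u' i' < q'"
    using x y by (auto simp: bier_index_def)
  have zero: "u k = 0" if "k \<notin> {1..n}" for k
    using u(1) M that by (auto simp: multicomplex_def cmonomials_def)
  obtain k where k: "k \<in> {1..n}"
    and eq: "\<And>j. j \<in> {1..<k} \<Longrightarrow> position_key (u', i', q') j = position_key (u, i, q) j"
    and lt: "position_key (u', i', q') k < position_key (u, i, q) k"
    using less unfolding shelling_key_less_iff by blast
  \<comment> \<open>Were \<open>i' < k\<close>, the keys would agree at \<open>i'\<close>, but only
    that of \<open>u'\<close> has a positive second component there.\<close>
  have i'k: "k \<le> i'" if "k \<le> i"
    using eq[of i'] that u'(2) by (cases "i' < k") (auto split: if_splits)
  have i'i: "i' = i" if "i < k"
    using eq[of i] eq[of i'] that u(2) u'(2) by (cases "i' < k") (auto split: if_splits)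
  consider (left) "k < i" | (right) "i < k" | (mid) "k = i" by linarith
  then show ?thesis
  proof cases
    case left
    then show ?thesis using lt i'k k by (intro bexI[of _ k]) (auto split: if_splits)
  next
    case right
    then show ?thesis using lt i'i k by (intro bexI[of _ k]) (auto split: if_splits)
  next
    case mid
    show ?thesis
    proof (cases "i' = i")
      case True
      then show ?thesis using lt mid k by (intro bexI[of _ i]) (auto split: if_splits)
    next
      case False
      then have i': "i < i'" using i'k mid by simp
      show ?thesis
      proof (cases "u' i = q")
        case False
        then show ?thesis using lt mid k i' by (intro bexI[of _ i]) (auto split: if_splits)
      next
        case True
        \<comment> \<open>Both vectors agree up to position \<open>i\<close>, so \<open>u(i := q) \<notin> M\<close> exceeds \<open>u' \<in> M\<close> further right.\<close>
        obtain j where j: "u' j < (u(i := q)) j"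
          using multicomplex_downward[OF M u'(1), of "u(i := q)"] u(4) by (meson not_le)
        have jn: "j \<in> {1..n}" using j zero[of j] u(2) by (cases "j \<in> {1..n}") (auto split: if_splits)
        have "\<not> j < i" using eq[of j] j jn mid i' by auto
        then have "i < j" using j True by (cases "i = j") auto
        then show ?thesis using j jn by (intro bexI[of _ j]) auto
      qed
    qed
  qed
qed

section \<open>Finiteness and existence of edges leaving the multicomplex\<close>

lemma finite_cmonomials: "finite (cmonomials n c)"
proof (rule finite_subset)
  show "cmonomials n c \<subseteq> {a. \<forall>i. (i \<in> {1..n} \<longrightarrow> a i \<in> {..sum c {1..n}}) \<and> (i \<notin> {1..n} \<longrightarrow> a i = 0)}"
  proof
    fix a assume "a \<in> cmonomials n c"
    then have a: "\<And>i. i \<in> {1..n} \<Longrightarrow> a i \<le> c i" "\<And>i. i \<notin> {1..n} \<Longrightarrow> a i = 0"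
      by (auto simp: cmonomials_def)
    have "a i \<le> sum c {1..n}" if "i \<in> {1..n}" for i
      using a(1)[OF that] member_le_sum[OF that, of c] by simp
    then show "a \<in> {a. \<forall>i. (i \<in> {1..n} \<longrightarrow> a i \<in> {..sum c {1..n}}) \<and> (i \<notin> {1..n} \<longrightarrow> a i = 0)}"
      using a(2) by simp
  qed
  show "finite {a. \<forall>i. (i \<in> {1..n} \<longrightarrow> a i \<in> {..sum c {1..n}}) \<and> (i \<notin> {1..n} \<longrightarrow> a i = (0::nat))}"
    by (rule finite_set_of_finite_funs) auto
qed

lemma finite_bier_index:
  assumes "multicomplex n c M"
  shows "finite (bier_index n c M)"
proof (rule finite_subset)
  show "bier_index n c M \<subseteq> cmonomials n c \<times> (SIGMA i:{1..n}. {..c i})"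
    using assms by (auto simp: bier_index_def multicomplex_def)
qed (simp add: finite_cmonomials)

text \<open>Take \<open>w\<close> of least degree among the monomials outside \<open>M\<close>. It
  has a positive entry, and by minimality setting that entry to 0 lands in \<open>M\<close>;
  restoring it is the required edge.\<close>

lemma bier_index_nonempty:
  assumes "proper_multicomplex n c M"
  shows "bier_index n c M \<noteq> {}"
proof -
  have M: "multicomplex n c M" and ne: "M \<noteq> cmonomials n c"
    using assms by (auto simp: proper_multicomplex_def full_multicomplex_def)
  obtain w0 where "w0 \<in> cmonomials n c - M" using M ne by (auto simp: multicomplex_def)
  then obtain w where w: "w \<in> cmonomials n c - M"
    and least: "\<And>v. v \<in> cmonomials n c - M \<Longrightarrow> sum w {1..n} \<le> sum v {1..n}"
    using ex_has_least_nat[of "\<lambda>w. w \<in> cmonomials n c - M" w0 "\<lambda>w. sum w {1..n}"] by blast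
  obtain u0 where "u0 \<in> M" using M by (auto simp: multicomplex_def)
  then have "\<not> (\<forall>i. w i \<le> u0 i)" using multicomplex_downward[OF M, of u0 w] w by auto
  then obtain i where "0 < w i" by (metis not_le gr_zeroI le0)
  moreover from this have i: "i \<in> {1..n}" "w i \<le> c i" using w by (force simp: cmonomials_def)+
  moreover have "w(i := 0) \<in> M"
  proof (rule ccontr)
    assume "w(i := 0) \<notin> M"
    then have "sum w {1..n} \<le> sum (w(i := 0)) {1..n}"
      using w i by (intro least) (auto intro: cmonomial_upd)
    moreover have "sum (w(i := 0)) {1..n} < sum w {1..n}"
      using i \<open>0 < w i\<close> by (intro sum_strict_mono_ex1) auto
    ultimately show False by simp
  qed
  ultimately have "(w(i := 0), i, w i) \<in> bier_index n c M" using w by (auto simp: bier_index_def)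
  then show ?thesis by auto
qed

section \<open>Identification of the facets of the Bier sphere\<close>

lemma subset_bier_facet_iff:
  assumes "v \<in> cmonomials n c" "u \<in> cmonomials n c" "i \<in> {1..n}"
  shows "bier_facet n c u - {(i, q)} \<subseteq> bier_facet n c v \<longleftrightarrow> v = u \<or> v = u(i := q)"
proof
  assume sub: "bier_facet n c u - {(i, q)} \<subseteq> bier_facet n c v"
  \<comment> \<open>The symbol \<open>(j, v j)\<close> is missing from the larger set, hence from
    the smaller one, which lacks only the symbols of \<open>u\<close> and
    \<open>(i, q)\<close>.\<close>
  have "v j = u j \<or> j = i \<and> v j = q" if "j \<in> {1..n}" for j
  proof -
    have "(j, v j) \<in> vertices n c" "(j, v j) \<notin> bier_facet n c v"
      using assms(1) that by (auto simp: bier_facet_def vertices_def cmonomials_def)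
    then have "(j, v j) \<notin> bier_facet n c u - {(i, q)}" using sub by blast
    then show ?thesis using \<open>(j, v j) \<in> vertices n c\<close> by (auto simp: mem_bier_facet_iff)
  qed
  then have "v j = u j \<or> j = i \<and> v j = q" for j
    using assms(1,2) by (cases "j \<in> {1..n}") (auto simp: cmonomials_def)
  then show "v = u \<or> v = u(i := q)" by (cases "v i = u i") (fastforce simp: fun_eq_iff)+
qed (auto simp: bier_facet_def)

lemma card_sphere_facet:
  assumes "multicomplex n c M" "x \<in> bier_index n c M"
  shows "card (sphere_facet n c x) + 1 = (\<Sum>i=1..n. c i)"
proof -
  obtain u i q where x: "x = (u, i, q)" by (metis prod_cases3)
  have u: "u \<in> cmonomials n c" using assms by (auto simp: x bier_index_def multicomplex_def)
  have "(i, q) \<in> bier_facet n c u" "finite (bier_facet n c u)"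
    using assms(2) by (auto simp: x bier_index_def bier_facet_def vertices_def finite_vertices)
  then show ?thesis using card_bier_facet[OF u] by (simp add: x card_Suc_Diff1 del: card_Diff_insert)
qed

text \<open>A ridge of the ball is \<open>bier_facet n c u - {(i, q)}\<close> with \<open>u\<close>
  in \<open>M\<close>, and only \<open>u\<close> and \<open>u(i := q)\<close> can have facets
  containing it. It is a boundary ridge exactly when \<open>u(i := q)\<close> lies outside
  \<open>M\<close>.\<close>

lemma bier_sphere_eq_generated:
  assumes M: "multicomplex n c M"
  shows "bier_sphere n c M = generated (sphere_facet n c ` bier_index n c M)"
proof -
  have Mc: "u \<in> cmonomials n c" if "u \<in> M" for u using M that by (auto simp: multicomplex_def)
  have inj: "inj_on (bier_facet n c) (cmonomials n c)"
  proof (rule inj_onI, rule ext)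
    fix u v j assume uv: "u \<in> cmonomials n c" "v \<in> cmonomials n c" "bier_facet n c u = bier_facet n c v"
    show "u j = v j"
    proof (cases "j \<in> {1..n}")
      case True
      then have "(j, u j) \<in> vertices n c - bier_facet n c v"
        using uv by (auto simp: bier_facet_def vertices_def cmonomials_def)
      then show ?thesis by (auto simp: bier_facet_def)
    next
      case False
      then show ?thesis using uv by (auto simp: cmonomials_def)
    qed
  qed
  have "{G \<in> bier_ball n c M. card G + 1 = sc_rank (bier_ball n c M) \<and>
      (\<exists>!F. F \<in> facets (bier_ball n c M) \<and> G \<subseteq> F)} = sphere_facet n c ` bier_index n c M"
    (is "?L = ?R")
  proof (intro equalityI subsetI)
    fix G assume "G \<in> ?L"
    then have cG: "card G + 1 = (\<Sum>i=1..n. c i)"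
      and ex1: "\<exists>!F. F \<in> bier_facet n c ` M \<and> G \<subseteq> F"
      unfolding bier_ball_pure[OF M] by blast+
    from ex1 obtain u where u: "u \<in> M" "G \<subseteq> bier_facet n c u" by blast
    then have uniq: "bier_facet n c v = bier_facet n c u" if "v \<in> M" "G \<subseteq> bier_facet n c v" for v
      using ex1 that by blast
    have fin: "finite (bier_facet n c u)" by (simp add: bier_facet_def finite_vertices)
    have "card (bier_facet n c u - G) = 1"
      using card_Diff_subset[OF finite_subset[OF u(2) fin] u(2)] card_bier_facet[OF Mc[OF u(1)]] cG by simp
    then obtain i q where iq: "bier_facet n c u - G = {(i, q)}" by (metis card_1_singletonE surj_pair)
    then have G: "G = bier_facet n c u - {(i, q)}" using u(2) by blast
    have "(i, q) \<in> bier_facet n c u" using iq by auto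
    then have i: "i \<in> {1..n}" "q \<le> c i" "q \<noteq> u i" by (auto simp: bier_facet_def vertices_def)
    have w: "u(i := q) \<in> cmonomials n c" using cmonomial_upd Mc u(1) i by blast
    have "G \<subseteq> bier_facet n c (u(i := q))"
      unfolding G using subset_bier_facet_iff[OF w Mc[OF u(1)] i(1), of q] by simp
    then have notin: "u(i := q) \<notin> M"
      using uniq[of "u(i := q)"] inj_onD[OF inj _ w Mc[OF u(1)]] i(3) by (metis fun_upd_same)
    \<comment> \<open>Lowering an entry of \<open>u\<close> would stay inside
      \<open>M\<close>.\<close>
    then have "u i < q"
      using multicomplex_downward[OF M u(1), of "u(i := q)"] i(3)
      by (metis fun_upd_apply le_refl linorder_neqE_nat nat_less_le)
    then show "G \<in> ?R" using u i notin G
      by (intro image_eqI[of _ _ "(u, i, q)"]) (auto simp: bier_index_def)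
  next
    fix G assume "G \<in> ?R"
    then obtain u i q where x: "(u, i, q) \<in> bier_index n c M" and G: "G = sphere_facet n c (u, i, q)" by auto
    then have u: "u \<in> M" "i \<in> {1..n}" "u(i := q) \<notin> M" by (auto simp: bier_index_def)
    have "v = u" if "v \<in> M" "G \<subseteq> bier_facet n c v" for v
      using subset_bier_facet_iff[OF Mc[OF that(1)] Mc[OF u(1)] u(2), of q] that u(3) G by auto
    moreover have "G \<subseteq> bier_facet n c u" using G by auto
    moreover have "G \<in> bier_ball n c M" using u(1) G by (auto simp: bier_ball_def generated_def)
    ultimately show "G \<in> ?L"
      using card_sphere_facet[OF M x] u(1) unfolding bier_ball_pure[OF M] G by blast
  qed
  then show ?thesis by (simp add: bier_sphere_def boundary_def)
qed

theorem theorem2p1: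
  fixes n :: nat and c :: "nat \<Rightarrow> nat" and M :: "(nat \<Rightarrow> nat) set"
  assumes "n \<ge> 1"
    and "proper_multicomplex n c M"
  shows "shellable (bier_sphere n c M)"
proof -
  have M: "multicomplex n c M" using assms(2) by (simp add: proper_multicomplex_def)
  show ?thesis
    unfolding bier_sphere_eq_generated[OF M]
  \<comment> \<open>The subtraction does not truncate: by \<open>card_sphere_facet\<close> the sum
    is positive as soon as an edge exists.\<close>
  proof (rule shellable_generated_by_key[where key = "shelling_key n" and d = "(\<Sum>i=1..n. c i) - 1"])
    fix x y assume x: "x \<in> bier_index n c M" and y: "y \<in> bier_index n c M"
      and less: "shelling_key n y < shelling_key n x"
    obtain u i q u' i' q' where xy: "x = (u, i, q)" "y = (u', i', q')" by (metis prod_cases3)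
    obtain j r where j: "j \<in> {1..n}" and r: "r = u' j \<or> j = i' \<and> r = q'"
      and dir: "j < i \<and> u j < r \<or> i < j \<and> r < u j \<or> j = i \<and> (r < u i \<or> q < r)"
      using exchange_direction_exists[OF M x[unfolded xy] y[unfolded xy] less[unfolded xy]] by blast
    have rc: "r \<le> c j"
      using r j y M by (auto simp: xy bier_index_def multicomplex_def cmonomials_def)
    obtain z where "z \<in> bier_index n c M" "shelling_key n z < shelling_key n x"
      "sphere_facet n c x - {(j, r)} \<subseteq> sphere_facet n c z"
      using exchange_to_smaller_key[OF M x[unfolded xy] j rc dir] by (auto simp: xy)
    \<comment> \<open>Each case of \<open>dir\<close> makes \<open>r\<close> differ from
      \<open>u j\<close>, and from \<open>q\<close> if \<open>j = i\<close>, so the symbol survives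
      in the facet of \<open>x\<close>.\<close>
    moreover have "(j, r) \<in> sphere_facet n c x - sphere_facet n c y"
      using j rc r dir x by (auto simp: xy bier_index_def bier_facet_def vertices_def)
    ultimately show "\<exists>z\<in>bier_index n c M. \<exists>v\<in>sphere_facet n c x - sphere_facet n c y.
        shelling_key n z < shelling_key n x \<and> sphere_facet n c x - {v} \<subseteq> sphere_facet n c z"
      by blast
  next
    fix x assume x: "x \<in> bier_index n c M"
    show "finite (sphere_facet n c x)"
      by (cases x) (simp add: bier_facet_def finite_vertices)
    show "card (sphere_facet n c x) = (\<Sum>i=1..n. c i) - 1"
      using card_sphere_facet[OF M x] by simp
  qed (use assms M finite_bier_index bier_index_nonempty inj_on_shelling_key in auto)
qed

end
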